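(* Let $M, N$ be positive integers with $N \geq 4M-4$. Then for a generic frame $\Phi = \{\phi_n\}_{n=1}^N \subset \mathbb{C}^M$ the map $\mathcal{A}_\Phi \colon (\mathbb{C}^M/S^1) \to (\mathbb{R}_{\geq 0})^N$, $x \mapsto (|\langle x, \phi_n\rangle|^2)_{n=1,\dots,N}$, is injective. That is, there is a non-empty Zariski open subset $\mathcal{U}$ of the real affine space $(\mathbb{R}^{M\times N})^2 \cong \mathbb{C}^{M\times N}$, consisting of frames, such that $\mathcal{A}_\Phi$ is injective for every frame $\Phi$ corresponding to a point of $\mathcal{U}$.
   Context: $\mathbb{C}^M$ carries the inner product $\langle x, y\rangle = \sum_{m=1}^M x_m \overline{y_m}$. An $N$-element complex frame is a collection $\Phi = \{\phi_1,\dots,\phi_N\}$ of vectors that span $\mathbb{C}^M$; it is identified with the full-rank $M\times N$ complex matrix with columns $\phi_1,\dots,\phi_N$. Via $\Phi = U + \mathrm{i}V$ with $U, V \in \mathbb{R}^{M\times N}$, $\mathbb{C}^{M\times N}$ is identified with $(\mathbb{R}^{M\times N})^2$. The quotient $\mathbb{C}^M/S^1$ is obtained by identifying $x \in \mathbb{C}^M$ with $e^{\mathrm{i}\theta}x$ for every real $\theta$. The Zariski topology on $(\mathbb{R}^{M\times N})^2$ is the one whose closed sets are the common zero sets of finitely many polynomials with real coefficients in the $2MN$ real coordinates. *)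

theory Defs
  imports "HOL-Analysis.Analysis"
begin

section \<open>Zariski topology on a real affine space\<close>

text \<open>
  \<^const>\<open>real_polynomial_function\<close> is generated from the bounded linear functionals and the
  constants by sums and products. On a Euclidean space the bounded linear functionals are exactly
  the real linear forms in the coordinates (see \<open>bounded_linear_iff_linear_form\<close> below), so these
  are exactly the functions given by polynomials with real coefficients in the coordinates.
\<close>

lemma bounded_linear_iff_linear_form:
  fixes f :: "'a::euclidean_space \<Rightarrow> real"
  shows "bounded_linear f \<longleftrightarrow> (\<exists>c. f = (\<lambda>x. \<Sum>b\<in>Basis. c b * (x \<bullet> b)))"
proof
  assume "bounded_linear f"
  then interpret bounded_linear f .
  have "f x = (\<Sum>b\<in>Basis. f b * (x \<bullet> b))" for x
  proof -
    have "f x = f (\<Sum>b\<in>Basis. (x \<bullet> b) *\<^sub>R b)"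
      by (simp add: euclidean_representation)
    also have "\<dots> = (\<Sum>b\<in>Basis. f b * (x \<bullet> b))"
      by (simp add: sum scaleR mult.commute)
    finally show ?thesis .
  qed
  then show "\<exists>c. f = (\<lambda>x. \<Sum>b\<in>Basis. c b * (x \<bullet> b))"
    by blast
next
  assume "\<exists>c. f = (\<lambda>x. \<Sum>b\<in>Basis. c b * (x \<bullet> b))"
  then show "bounded_linear f"
    by (auto intro!: bounded_linear_intros)
qed

definition zariski_closed :: "'a::euclidean_space set \<Rightarrow> bool" where
  "zariski_closed Z \<longleftrightarrow>
    (\<exists>F. finite F \<and> (\<forall>f\<in>F. real_polynomial_function f) \<and> Z = {x. \<forall>f\<in>F. f x = 0})"

definition zariski_open :: "'a::euclidean_space set \<Rightarrow> bool" where
  "zariski_open U \<longleftrightarrow> zariski_closed (- U)"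


section \<open>Complex frames\<close>

definition complex_matrix ::
  "(real ^ 'n ^ 'm) \<times> (real ^ 'n ^ 'm) \<Rightarrow> complex ^ 'n ^ 'm" where
  "complex_matrix P = (\<chi> i j. Complex (fst P $ i $ j) (snd P $ i $ j))"

text \<open>
  The span is taken over the complex numbers; plain \<^const>\<open>span\<close> would be the real span.
\<close>

definition is_frame :: "complex ^ 'n ^ 'm \<Rightarrow> bool" where
  "is_frame \<Phi> \<longleftrightarrow> vec.span (columns \<Phi>) = UNIV"

text \<open>
  The library's inner product on \<^typ>\<open>complex ^ 'm\<close> is the real one, hence this definition.
\<close>

definition cinner :: "complex ^ 'm \<Rightarrow> complex ^ 'm \<Rightarrow> complex" where
  "cinner x y = (\<Sum>m\<in>UNIV. x $ m * cnj (y $ m))"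


section \<open>Intensity measurements modulo a global phase\<close>

definition phase_equiv :: "complex ^ 'm \<Rightarrow> complex ^ 'm \<Rightarrow> bool" where
  "phase_equiv x y \<longleftrightarrow> (\<exists>\<theta>::real. y = exp (\<i> * of_real \<theta>) *s x)"

lemma equivp_phase_equiv: "equivp (phase_equiv :: complex ^ 'm \<Rightarrow> _)"
proof (rule equivpI)
  show "reflp (phase_equiv :: complex ^ 'm \<Rightarrow> _)"
  proof (rule reflpI)
    fix x :: "complex ^ 'm"
    have "x = exp (\<i> * of_real 0) *s x"
      by simp
    then show "phase_equiv x x"
      unfolding phase_equiv_def by blast
  qed
  show "symp (phase_equiv :: complex ^ 'm \<Rightarrow> _)"
  proof (rule sympI)
    fix x y :: "complex ^ 'm"
    assume "phase_equiv x y"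
    then obtain t :: real where "y = exp (\<i> * of_real t) *s x"
      unfolding phase_equiv_def by blast
    then have "x = exp (\<i> * of_real (- t)) *s y"
      by (simp add: vector_smult_assoc flip: exp_add)
    then show "phase_equiv y x"
      unfolding phase_equiv_def by blast
  qed
  show "transp (phase_equiv :: complex ^ 'm \<Rightarrow> _)"
  proof (rule transpI)
    fix x y z :: "complex ^ 'm"
    assume "phase_equiv x y" "phase_equiv y z"
    then obtain s t :: real
      where "y = exp (\<i> * of_real s) *s x" "z = exp (\<i> * of_real t) *s y"
      unfolding phase_equiv_def by blast
    then have "z = exp (\<i> * of_real (t + s)) *s x"
      by (simp add: vector_smult_assoc distrib_left exp_add)
    then show "phase_equiv x z"
      unfolding phase_equiv_def by blast
  qed
qed

quotient_type 'm phase_class = "complex ^ ('m::finite)" / phase_equiv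
  by (rule equivp_phase_equiv)

lift_definition intensity_map :: "complex ^ 'n ^ 'm \<Rightarrow> 'm::finite phase_class \<Rightarrow> real ^ 'n"
  is "\<lambda>\<Phi> x. \<chi> n. (cmod (cinner x (column n \<Phi>)))\<^sup>2"
proof -
  fix \<Phi> :: "complex ^ 'n ^ 'm" and x y :: "complex ^ 'm"
  assume "phase_equiv x y"
  then obtain t :: real where y: "y = exp (\<i> * of_real t) *s x"
    unfolding phase_equiv_def by blast
  have "cinner y v = exp (\<i> * of_real t) * cinner x v" for v
    by (simp add: y cinner_def sum_distrib_left mult.assoc)
  then show "(\<chi> n. (cmod (cinner x (column n \<Phi>)))\<^sup>2) = (\<chi> n. (cmod (cinner y (column n \<Phi>)))\<^sup>2)"
    by (simp add: norm_mult)
qed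

lemma intensity_map_nonneg: "0 \<le> intensity_map \<Phi> X $ n"
  by transfer simp

end

theory Submission
  imports Defs
begin

text \<open>
  If \<open>x\<close> and \<open>y\<close> have the same intensities without being equal up to a phase, then every column of
  the frame is a zero of the Hermitian form \<open>x x\<^sup>* - y y\<^sup>*\<close>, which is non-zero of rank at most two.
  Up to a real factor such forms depend on \<open>4M - 5\<close> real parameters: \<open>4M - 8\<close> for a two-dimensional
  space \<open>\<langle>v, w\<rangle>\<close> containing \<open>x\<close> and \<open>y\<close>, normalized in two pivot coordinates, and \<open>3\<close> for the
  form on it. The zeros of a given form depend on \<open>2M - 1\<close> parameters. Hence the bad frames are
  covered by the images of finitely many polynomial maps in \<open>4M - 5 + N (2M - 1) < 2MN\<close> real
  variables, and comparing numbers of monomials shows that each image lies in the zero set of a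
  non-zero polynomial.
\<close>

section \<open>Polynomial functions in finitely many variables\<close>

definition monomial :: "'i set \<Rightarrow> ('i \<Rightarrow> nat) \<Rightarrow> ('i \<Rightarrow> real) \<Rightarrow> real" where
  "monomial I e x = (\<Prod>i\<in>I. x i ^ e i)"

text \<open>The degree is bounded in each variable separately, so the exponents form a box whose
  cardinality is a power. Since \<open>PiE\<close> is extensional, each monomial has exactly one
  exponent in the box.\<close>

definition poly_degree_le :: "'i set \<Rightarrow> nat \<Rightarrow> (('i \<Rightarrow> real) \<Rightarrow> real) \<Rightarrow> bool" where
  "poly_degree_le I m f \<longleftrightarrow>
    (\<exists>a. \<forall>x. f x = (\<Sum>e\<in>PiE I (\<lambda>_. {..m}). a e * monomial I e x))"

definition poly_on :: "'i set \<Rightarrow> (('i \<Rightarrow> real) \<Rightarrow> real) \<Rightarrow> bool" where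
  "poly_on I f \<longleftrightarrow> (\<exists>m. poly_degree_le I m f)"

lemma poly_degree_le_zero: "poly_degree_le I m (\<lambda>_. 0)"
  unfolding poly_degree_le_def by (rule exI[of _ "\<lambda>_. 0"]) simp

lemma poly_degree_le_add:
  assumes "poly_degree_le I m f" "poly_degree_le I m g"
  shows "poly_degree_le I m (\<lambda>x. f x + g x)"
proof -
  obtain a b where "\<forall>x. f x = (\<Sum>e\<in>PiE I (\<lambda>_. {..m}). a e * monomial I e x)"
    "\<forall>x. g x = (\<Sum>e\<in>PiE I (\<lambda>_. {..m}). b e * monomial I e x)"
    using assms unfolding poly_degree_le_def by blast
  then show ?thesis
    unfolding poly_degree_le_def
    by (intro exI[of _ "\<lambda>e. a e + b e"]) (simp add: sum.distrib distrib_right)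
qed

lemma poly_degree_le_cmult:
  assumes "poly_degree_le I m f"
  shows "poly_degree_le I m (\<lambda>x. c * f x)"
proof -
  obtain a where "\<forall>x. f x = (\<Sum>e\<in>PiE I (\<lambda>_. {..m}). a e * monomial I e x)"
    using assms unfolding poly_degree_le_def by blast
  then show ?thesis
    unfolding poly_degree_le_def
    by (intro exI[of _ "\<lambda>e. c * a e"]) (simp add: sum_distrib_left mult.assoc)
qed

lemma poly_degree_le_sum:
  assumes "\<And>j. j \<in> J \<Longrightarrow> poly_degree_le I m (\<lambda>x. f x j)"
  shows "poly_degree_le I m (\<lambda>x. \<Sum>j\<in>J. f x j)"
  using assms
  by (induction J rule: infinite_finite_induct)
     (auto intro: poly_degree_le_zero poly_degree_le_add)

lemma poly_degree_le_monomial: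
  assumes "finite I" "\<And>i. i \<in> I \<Longrightarrow> e i \<le> m"
  shows "poly_degree_le I m (monomial I e)"
proof -
  let ?E = "PiE I (\<lambda>_. {..m})" and ?e = "restrict e I"
  have "?e \<in> ?E" and "finite ?E"
    using assms by (auto intro: finite_PiE)
  moreover have "monomial I e x = monomial I ?e x" for x
    unfolding monomial_def by (rule prod.cong) auto
  ultimately show ?thesis
    unfolding poly_degree_le_def
    by (intro exI[of _ "\<lambda>d. if d = ?e then 1 else 0"]) (simp add: if_distribR if_distrib sum.delta' cong: if_cong)
qed

lemma poly_degree_le_mono:
  assumes "finite I" "poly_degree_le I m f" "m \<le> n"
  shows "poly_degree_le I n f"
proof -
  obtain a where a: "\<And>x. f x = (\<Sum>e\<in>PiE I (\<lambda>_. {..m}). a e * monomial I e x)"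
    using assms unfolding poly_degree_le_def by blast
  have "poly_degree_le I n (\<lambda>x. \<Sum>e\<in>PiE I (\<lambda>_. {..m}). a e * monomial I e x)"
    using assms by (intro poly_degree_le_sum poly_degree_le_cmult poly_degree_le_monomial)
      (auto simp: PiE_iff intro: order_trans)
  then show ?thesis by (simp add: a[abs_def])
qed

lemma poly_degree_le_mult:
  assumes "finite I" "poly_degree_le I m f" "poly_degree_le I n g"
  shows "poly_degree_le I (m + n) (\<lambda>x. f x * g x)"
proof -
  obtain a b where a: "\<And>x. f x = (\<Sum>e\<in>PiE I (\<lambda>_. {..m}). a e * monomial I e x)"
    and b: "\<And>x. g x = (\<Sum>e\<in>PiE I (\<lambda>_. {..n}). b e * monomial I e x)"
    using assms unfolding poly_degree_le_def by blast
  have "f x * g x = (\<Sum>d\<in>PiE I (\<lambda>_. {..m}). \<Sum>e\<in>PiE I (\<lambda>_. {..n}).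
      (a d * b e) * monomial I (\<lambda>i. d i + e i) x)" for x
    unfolding a b sum_product
    by (intro sum.cong refl) (simp add: monomial_def power_add prod.distrib)
  moreover have "poly_degree_le I (m + n) (\<lambda>x. \<Sum>d\<in>PiE I (\<lambda>_. {..m}). \<Sum>e\<in>PiE I (\<lambda>_. {..n}).
      (a d * b e) * monomial I (\<lambda>i. d i + e i) x)"
    using assms(1) by (intro poly_degree_le_sum poly_degree_le_cmult poly_degree_le_monomial)
      (auto simp: PiE_iff intro: add_mono)
  ultimately show ?thesis by simp
qed

lemma poly_degree_le_const:
  assumes "finite I"
  shows "poly_degree_le I m (\<lambda>_. c)"
proof -
  have "poly_degree_le I m (\<lambda>x. c * monomial I (\<lambda>_. 0) x)"
    using assms by (intro poly_degree_le_cmult poly_degree_le_monomial) auto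
  then show ?thesis by (simp add: monomial_def)
qed

lemma poly_degree_le_power:
  assumes "finite I" "poly_degree_le I m f"
  shows "poly_degree_le I (m * k) (\<lambda>x. f x ^ k)"
proof (induction k)
  case 0
  then show ?case using assms(1) by (simp add: poly_degree_le_const)
next
  case (Suc k)
  then show ?case using poly_degree_le_mult[OF assms Suc] by simp
qed

lemma poly_degree_le_prod:
  assumes "finite I" "\<And>j. j \<in> J \<Longrightarrow> poly_degree_le I m (\<lambda>x. f x j)"
  shows "poly_degree_le I (m * card J) (\<lambda>x. \<Prod>j\<in>J. f x j)"
  using assms(2)
proof (induction J rule: infinite_finite_induct)
  case (insert j J)
  then show ?case
    using poly_degree_le_mult[OF assms(1), of m "\<lambda>x. f x j" "m * card J" "\<lambda>x. \<Prod>j\<in>J. f x j"]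
    by simp
qed (use assms(1) in \<open>simp_all add: poly_degree_le_const\<close>)

lemma poly_on_const: "finite I \<Longrightarrow> poly_on I (\<lambda>_. c)"
  unfolding poly_on_def using poly_degree_le_const by blast

lemma poly_on_var:
  assumes "finite I" "i \<in> I"
  shows "poly_on I (\<lambda>x. x i)"
proof -
  have "poly_degree_le I 1 (monomial I (\<lambda>j. if j = i then 1 else 0))"
    using assms by (intro poly_degree_le_monomial) auto
  moreover have "monomial I (\<lambda>j. if j = i then 1 else 0) = (\<lambda>x. x i)"
    using assms unfolding monomial_def by (auto simp: fun_eq_iff if_distrib cong: if_cong)
  ultimately show ?thesis unfolding poly_on_def by auto
qed

lemma poly_on_mult:
  "finite I \<Longrightarrow> poly_on I f \<Longrightarrow> poly_on I g \<Longrightarrow> poly_on I (\<lambda>x. f x * g x)"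
  unfolding poly_on_def using poly_degree_le_mult by blast

lemma poly_on_add:
  assumes "finite I" "poly_on I f" "poly_on I g"
  shows "poly_on I (\<lambda>x. f x + g x)"
proof -
  obtain m n where "poly_degree_le I m f" "poly_degree_le I n g"
    using assms unfolding poly_on_def by blast
  then have "poly_degree_le I (max m n) (\<lambda>x. f x + g x)"
    using poly_degree_le_mono[OF assms(1)] by (intro poly_degree_le_add) auto
  then show ?thesis unfolding poly_on_def by blast
qed

lemma poly_on_uminus: "finite I \<Longrightarrow> poly_on I f \<Longrightarrow> poly_on I (\<lambda>x. - f x)"
  using poly_on_mult[OF _ poly_on_const[of I "-1"], of f] by simp

lemma poly_on_diff: "finite I \<Longrightarrow> poly_on I f \<Longrightarrow> poly_on I g \<Longrightarrow> poly_on I (\<lambda>x. f x - g x)"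
  using poly_on_add[of I f "\<lambda>x. - g x"] poly_on_uminus[of I g] by simp

lemma poly_on_sum:
  assumes "finite I" "\<And>j. j \<in> J \<Longrightarrow> poly_on I (\<lambda>x. f x j)"
  shows "poly_on I (\<lambda>x. \<Sum>j\<in>J. f x j)"
  using assms(2)
  by (induction J rule: infinite_finite_induct)
     (auto intro: poly_on_const[OF assms(1)] poly_on_add[OF assms(1)])

section \<open>Polynomial maps in too few variables have their image in a hypersurface\<close>

lemma monomials_independent:
  assumes "finite I" "\<And>x. (\<Sum>e\<in>PiE I (\<lambda>_. {..m}). c e * monomial I e x) = 0"
    and "e \<in> PiE I (\<lambda>_. {..m})"
  shows "c e = 0"
  using assms
proof (induction I arbitrary: c e rule: finite_induct)
  case empty
  then show ?case by (simp add: monomial_def)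
next
  case (insert i I)
  let ?E = "PiE I (\<lambda>_. {..m})"
  have mon: "monomial (insert i I) (d(i := k)) (x(i := t)) = t ^ k * monomial I d x" for d k x t
  proof -
    have "(\<Prod>j\<in>I. (x(i := t)) j ^ (d(i := k)) j) = (\<Prod>j\<in>I. x j ^ d j)"
      using insert(2) by (intro prod.cong) auto
    then show ?thesis using insert(1,2) by (simp add: monomial_def)
  qed
  \<comment> \<open>With the variables in \<open>I\<close> fixed, the sum is a univariate polynomial
    in \<open>t\<close> that vanishes identically. Its coefficients are polynomials in fewer
    variables, to which the induction hypothesis applies.\<close>
  have inner: "(\<Sum>d\<in>?E. c (d(i := k)) * monomial I d x) = 0" if "k \<le> m" for k x
  proof -
    have "(\<Sum>k\<le>m. (\<Sum>d\<in>?E. c (d(i := k)) * monomial I d x) * t ^ k) = 0" for t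
    proof -
      have "0 = (\<Sum>e\<in>PiE (insert i I) (\<lambda>_. {..m}). c e * monomial (insert i I) e (x(i := t)))"
        using insert(4) by simp
      also have "\<dots> = (\<Sum>(k, d)\<in>{..m} \<times> ?E. c (d(i := k)) * (t ^ k * monomial I d x))"
        unfolding PiE_insert_eq
        by (subst sum.reindex[OF inj_combinator[OF insert(2)]])
           (simp add: case_prod_unfold mon)
      also have "\<dots> = (\<Sum>k\<le>m. (\<Sum>d\<in>?E. c (d(i := k)) * monomial I d x) * t ^ k)"
        by (simp add: sum.cartesian_product[symmetric] sum_distrib_left sum_distrib_right mult_ac)
      finally show ?thesis by simp
    qed
    then show ?thesis using that polyfun_eq_0[where n = m and c = "\<lambda>k. \<Sum>d\<in>?E. c (d(i := k)) * monomial I d x"]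
      by blast
  qed
  obtain k d where e: "e = d(i := k)" "k \<le> m" "d \<in> ?E"
    using insert(5) unfolding PiE_insert_eq by auto
  show ?case
    unfolding e(1) by (rule insert(3)[of "\<lambda>d. c (d(i := k))" d, OF inner[OF e(2)] e(3)])
qed

text \<open>Gaussian elimination: each equation is either trivial or eliminates one unknown, so some
  unknown stays free.\<close>

lemma underdetermined_system_nontrivial:
  fixes a :: "'j \<Rightarrow> 't \<Rightarrow> real"
  assumes "finite T" "finite J" "card T < card J"
  shows "\<exists>c. (\<exists>j\<in>J. c j \<noteq> 0) \<and> (\<forall>\<tau>\<in>T. (\<Sum>j\<in>J. c j * a j \<tau>) = 0)"
  using assms
proof (induction T arbitrary: J a rule: finite_induct)
  case empty
  then have "J \<noteq> {}" by auto
  then show ?case by (intro exI[of _ "\<lambda>_. 1"]) auto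
next
  case (insert s T)
  show ?case
  proof (cases "\<forall>j\<in>J. a j s = 0")
    case True
    then show ?thesis using insert(3)[of J a] insert by auto
  next
    case False
    then obtain p where p: "p \<in> J" "a p s \<noteq> 0" by blast
    define J' where "J' = J - {p}"
    have J': "finite J'" "p \<notin> J'" "J = insert p J'" using p insert(4) by (auto simp: J'_def)
    have "card T < card J'" using insert J' by simp
    then obtain c where c: "\<exists>j\<in>J'. c j \<noteq> 0"
      "\<And>\<tau>. \<tau> \<in> T \<Longrightarrow> (\<Sum>j\<in>J'. c j * (a j \<tau> - a j s / a p s * a p \<tau>)) = 0"
      using insert(3)[OF J'(1), of "\<lambda>j \<tau>. a j \<tau> - a j s / a p s * a p \<tau>"] by blast
    \<comment> \<open>This is the value that equation \<open>s\<close> forces on the unknown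
      \<open>p\<close>. After substitution, equation \<open>\<tau>\<close> becomes the reduced one,
      and equation \<open>s\<close> becomes trivial.\<close>
    define C where "C = - (\<Sum>j\<in>J'. c j * (a j s / a p s))"
    let ?c = "c(p := C)"
    have eq: "(\<Sum>j\<in>J. ?c j * a j \<tau>) = (\<Sum>j\<in>J'. c j * (a j \<tau> - a j s / a p s * a p \<tau>))" for \<tau>
    proof -
      have "(\<Sum>j\<in>J. ?c j * a j \<tau>) = C * a p \<tau> + (\<Sum>j\<in>J'. c j * a j \<tau>)"
        using J' by (simp cong: sum.cong_simp) (intro sum.cong, auto)
      then show ?thesis
        by (simp add: C_def right_diff_distrib sum_subtractf sum_distrib_right mult.assoc)
    qed
    have "(\<Sum>j\<in>J. ?c j * a j \<tau>) = 0" if "\<tau> \<in> insert s T" for \<tau>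
      using that c(2) p(2) unfolding eq by auto
    moreover have "\<exists>j\<in>J. ?c j \<noteq> 0" using c(1) J' by auto
    ultimately show ?thesis by blast
  qed
qed

lemma polynomial_image_in_hypersurface:
  fixes F :: "('i \<Rightarrow> real) \<Rightarrow> 'a::euclidean_space"
  assumes I: "finite I" "card I < DIM('a)"
    and F: "\<And>b. b \<in> Basis \<Longrightarrow> poly_on I (\<lambda>x. F x \<bullet> b)"
  obtains p :: "'a \<Rightarrow> real" and x0
  where "real_polynomial_function p" "p x0 \<noteq> 0" "\<And>x. p (F x) = 0"
proof -
  let ?B = "Basis :: 'a set" and ?D = "DIM('a)"
  have "\<exists>m. \<forall>b\<in>?B. poly_degree_le I m (\<lambda>x. F x \<bullet> b)"
  proof -
    obtain m where m: "\<And>b. b \<in> ?B \<Longrightarrow> poly_degree_le I (m b) (\<lambda>x. F x \<bullet> b)"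
      using F unfolding poly_on_def by metis
    have "poly_degree_le I (\<Sum>b\<in>?B. m b) (\<lambda>x. F x \<bullet> b)" if "b \<in> ?B" for b
      using poly_degree_le_mono[OF I(1) m[OF that]] that member_le_sum[of b ?B m] by simp
    then show ?thesis by blast
  qed
  then obtain m where m: "\<And>b. b \<in> ?B \<Longrightarrow> poly_degree_le I m (\<lambda>x. F x \<bullet> b)" by blast
  \<comment> \<open>There are \<open>(k + 1) ^ DIM('a)\<close> monomials of degree at most \<open>k\<close> in each coordinate;
     composed with \<open>F\<close> they lie in a space of dimension at most
     \<open>(m * k * DIM('a) + 1) ^ card I\<close>, which is smaller once \<open>k\<close> is large.\<close>
  define k where "k = (m * ?D + 1) ^ card I"
  let ?J = "PiE ?B (\<lambda>_. {..k})" and ?T = "PiE I (\<lambda>_. {..m * k * ?D})"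
  have "card ?T = (m * k * ?D + 1) ^ card I"
    using I(1) by (simp add: card_PiE)
  \<comment> \<open>This bound makes the power split: the factor
    \<open>(m * ?D + 1) ^ card I\<close> is \<open>k\<close> itself by the choice of
    \<open>k\<close>, and \<open>k\<close> is beaten by one further factor
    \<open>k + 1\<close>.\<close>
  also have "\<dots> \<le> ((m * ?D + 1) * (k + 1)) ^ card I"
    by (intro power_mono) (auto simp: algebra_simps)
  also have "\<dots> = k * (k + 1) ^ card I"
    unfolding power_mult_distrib k_def by simp
  also have "\<dots> < (k + 1) ^ Suc (card I)"
    by simp
  also have "\<dots> \<le> (k + 1) ^ ?D"
    using I(2) by (intro power_increasing) auto
  also have "\<dots> = card ?J"
    by (simp add: card_PiE)
  finally have card: "card ?T < card ?J" .
  have "poly_degree_le I (m * k * ?D) (\<lambda>x. monomial ?B e (\<lambda>b. F x \<bullet> b))" if "e \<in> ?J" for e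
    unfolding monomial_def
  proof (intro poly_degree_le_prod I(1))
    fix b assume b: "b \<in> ?B"
    have "poly_degree_le I (m * e b) (\<lambda>x. (F x \<bullet> b) ^ e b)"
      by (intro poly_degree_le_power I(1) m b)
    then show "poly_degree_le I (m * k) (\<lambda>x. (F x \<bullet> b) ^ e b)"
      by (rule poly_degree_le_mono[OF I(1)]) (use that b in \<open>auto simp: PiE_iff\<close>)
  qed
  then obtain a where a: "\<And>e x. e \<in> ?J \<Longrightarrow>
      monomial ?B e (\<lambda>b. F x \<bullet> b) = (\<Sum>\<tau>\<in>?T. a e \<tau> * monomial I \<tau> x)"
    unfolding poly_degree_le_def by metis
  \<comment> \<open>The unknowns are the coefficients of \<open>p\<close>; there is one equation for
    each monomial that can occur in \<open>p\<close> composed with \<open>F\<close>.\<close>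
  obtain c where c: "\<exists>e\<in>?J. c e \<noteq> 0" "\<And>\<tau>. \<tau> \<in> ?T \<Longrightarrow> (\<Sum>e\<in>?J. c e * a e \<tau>) = 0"
    using underdetermined_system_nontrivial[OF _ _ card, of a] I(1)
    by (auto simp: finite_PiE)
  define p where "p = (\<lambda>y::'a. \<Sum>e\<in>?J. c e * monomial ?B e (\<lambda>b. y \<bullet> b))"
  have "real_polynomial_function p"
    unfolding p_def monomial_def
    by (intro real_polynomial_function_sum real_polynomial_function.intros(2,4)
        real_polynomial_function_prod real_polynomial_function_power
        real_polynomial_function.intros(1)[OF bounded_linear_inner_left] finite_PiE) auto
  moreover have "\<exists>y. p y \<noteq> 0"
  proof (rule ccontr)
    assume "\<nexists>y. p y \<noteq> 0"
    then have zero: "p y = 0" for y by blast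
    have "(\<Sum>e\<in>?J. c e * monomial ?B e x) = 0" for x
    proof -
      \<comment> \<open>Every coordinate function \<open>x\<close> is that of a point, so vanishing
        of \<open>p\<close> at all points gives the vanishing that independence of monomials
        requires.\<close>
      have "monomial ?B e x = monomial ?B e (\<lambda>b. (\<Sum>d\<in>?B. x d *\<^sub>R d) \<bullet> b)" for e
        unfolding monomial_def by (intro prod.cong) (auto simp: inner_sum_left inner_Basis if_distrib cong: if_cong)
      then show ?thesis using zero[of "\<Sum>d\<in>?B. x d *\<^sub>R d"] by (simp add: p_def)
    qed
    then show False using c(1) monomials_independent[where I = ?B and m = k and c = c] by auto
  qed
  moreover have "p (F x) = 0" for x
  proof -
    have "p (F x) = (\<Sum>e\<in>?J. \<Sum>\<tau>\<in>?T. (c e * a e \<tau>) * monomial I \<tau> x)"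
      by (simp add: p_def a sum_distrib_left mult.assoc)
    also have "\<dots> = (\<Sum>\<tau>\<in>?T. (\<Sum>e\<in>?J. c e * a e \<tau>) * monomial I \<tau> x)"
      by (subst sum.swap) (simp add: sum_distrib_right)
    also have "\<dots> = 0" using c(2) by simp
    finally show ?thesis .
  qed
  ultimately show ?thesis using that by blast
qed

text \<open>On the line through \<open>x\<close> and \<open>y\<close> both polynomials become
  univariate and non-zero, hence have finitely many roots; any other point of the line
  works.\<close>

lemma real_polynomial_function_mult_nonzero:
  fixes p q :: "'a::real_normed_vector \<Rightarrow> real"
  assumes p: "real_polynomial_function p" "p x \<noteq> 0" and q: "real_polynomial_function q" "q y \<noteq> 0"
  shows "\<exists>z. p z * q z \<noteq> 0"
proof -
  define l where "l = (\<lambda>t::real. x + t *\<^sub>R (y - x))"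
  have l: "polynomial_function l"
    unfolding l_def polynomial_function_def o_def
  proof (intro allI impI)
    fix f :: "'a \<Rightarrow> real" assume "bounded_linear f"
    then interpret f: bounded_linear f .
    show "real_polynomial_function (\<lambda>t. f (x + t *\<^sub>R (y - x)))"
      unfolding f.add f.scaleR real_scaleR_def
      by (intro real_polynomial_function.intros(2-4) real_polynomial_function.intros(1)[OF bounded_linear_ident])
  qed
  have fin: "finite {t. (r \<circ> l) t = 0}"
    if r: "real_polynomial_function r" "(r \<circ> l) t0 \<noteq> 0" for r :: "'a \<Rightarrow> real" and t0
  proof -
    obtain a n where "r \<circ> l = (\<lambda>t. \<Sum>i\<le>n. a i * t ^ i)"
      using real_polynomial_function_imp_sum[OF real_polynomial_function_compose[OF l r(1)]] by blast
    then show ?thesis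
      using r(2) polyfun_eq_0[of a n] polyfun_finite_roots[of a n] by auto
  qed
  have "finite ({t. (p \<circ> l) t = 0} \<union> {t. (q \<circ> l) t = 0})"
    using fin[OF p(1), of 0] fin[OF q(1), of 1] p(2) q(2) by (simp add: l_def)
  then obtain t where "t \<notin> {t. (p \<circ> l) t = 0} \<union> {t. (q \<circ> l) t = 0}"
    using infinite_UNIV_char_0 ex_new_if_finite by blast
  then show ?thesis by auto
qed

text \<open>The product of the polynomials vanishing on the individual images is non-zero and
  vanishes on all of them; the open set is where this product does not vanish.\<close>

lemma polynomial_images_avoid:
  fixes F :: "'k \<Rightarrow> ('i \<Rightarrow> real) \<Rightarrow> 'a::euclidean_space"
  assumes "finite K"
    and "\<And>\<kappa>. \<kappa> \<in> K \<Longrightarrow> finite (I \<kappa>)" "\<And>\<kappa>. \<kappa> \<in> K \<Longrightarrow> card (I \<kappa>) < DIM('a)"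
    and "\<And>\<kappa> b. \<kappa> \<in> K \<Longrightarrow> b \<in> Basis \<Longrightarrow> poly_on (I \<kappa>) (\<lambda>x. F \<kappa> x \<bullet> b)"
  shows "\<exists>U. zariski_open U \<and> U \<noteq> {} \<and> (\<forall>y\<in>U. \<forall>\<kappa>\<in>K. y \<notin> range (F \<kappa>))"
proof -
  have "\<exists>p x0. real_polynomial_function p \<and> p x0 \<noteq> 0 \<and> (\<forall>\<kappa>\<in>K. \<forall>x. p (F \<kappa> x) = 0)"
    using assms
  proof (induction K rule: finite_induct)
    case empty
    show ?case by (intro exI[of _ "\<lambda>_. 1"]) auto
  next
    case (insert \<kappa> K)
    then obtain p x0 where p: "real_polynomial_function p" "p x0 \<noteq> 0" "\<forall>\<kappa>\<in>K. \<forall>x. p (F \<kappa> x) = 0"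
      by auto
    obtain q y0 where q: "real_polynomial_function q" "q y0 \<noteq> 0" "\<And>x. q (F \<kappa> x) = 0"
      using polynomial_image_in_hypersurface[of "I \<kappa>" "F \<kappa>"] insert by auto
    obtain z where "p z * q z \<noteq> 0"
      using real_polynomial_function_mult_nonzero[OF p(1,2) q(1,2)] by blast
    then show ?case
      using p q by (intro exI[of _ "\<lambda>x. p x * q x"] exI[of _ z]) auto
  qed
  then obtain p x0 where p: "real_polynomial_function p" "p x0 \<noteq> 0"
    "\<And>\<kappa> x. \<kappa> \<in> K \<Longrightarrow> p (F \<kappa> x) = 0" by blast
  have "zariski_open {x. p x \<noteq> 0}"
    unfolding zariski_open_def zariski_closed_def
    using p(1) by (intro exI[of _ "{p}"]) auto
  then show ?thesis
    using p by (intro exI[of _ "{x. p x \<noteq> 0}"]) auto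
qed

section \<open>Pairs of vectors with equal intensities\<close>

text \<open>The hypotheses say that the matrices \<open>x x\<^sup>*\<close> and
  \<open>y y\<^sup>*\<close> agree. Such a matrix determines its vector up to a phase, which can be
  read off at a non-zero coordinate.\<close>

lemma phase_equiv_pair:
  fixes x1 x2 y1 y2 :: complex
  assumes "cmod x1 = cmod y1" "cmod x2 = cmod y2" "x1 * cnj x2 = y1 * cnj y2"
  shows "\<exists>\<theta>::real. y1 = exp (\<i> * of_real \<theta>) * x1 \<and> y2 = exp (\<i> * of_real \<theta>) * x2"
proof -
  have "\<exists>u. cmod u = 1 \<and> y1 = u * x1 \<and> y2 = u * x2"
  proof (cases "x1 = 0")
    case True
    then show ?thesis
      using assms
      \<comment> \<open>If \<open>x2 = 0\<close> as well, both vectors vanish and any phase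
        serves.\<close>
      by (intro exI[of _ "if x2 = 0 then 1 else y2 / x2"]) (auto simp: norm_divide)
  next
    case False
    let ?u = "y1 / x1"
    have u: "cmod ?u = 1" using False by (simp add: norm_divide flip: assms(1))
    then have "?u * cnj ?u = 1"
      using complex_norm_square[of ?u] unfolding u by simp
    have "y1 \<noteq> 0" using u by auto
    have "cnj y2 = cnj ?u * cnj x2"
    proof -
      have "y1 * (cnj ?u * cnj x2) = (?u * cnj ?u) * (x1 * cnj x2)"
        using False by simp
      also have "\<dots> = y1 * cnj y2" using \<open>?u * cnj ?u = 1\<close> assms(3) by simp
      finally show ?thesis using \<open>y1 \<noteq> 0\<close> by (metis mult_left_cancel)
    qed
    then have "y2 = ?u * x2" by (metis complex_cnj_cnj complex_cnj_mult)
    then show ?thesis using u False by (intro exI[of _ ?u]) simp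
  qed
  then obtain u where u: "cmod u = 1" "y1 = u * x1" "y2 = u * x2" by blast
  have "exp (\<i> * of_real (Arg u)) = u"
    using Arg_eq[of u] u(1) by (metis mult_1 norm_zero of_real_1 zero_neq_one)
  with u show ?thesis by (intro exI[of _ "Arg u"]) simp
qed

text \<open>Write \<open>p = r * q * z\<close> with \<open>z\<close> on the unit circle.
  Stereographic projection from \<open>-1\<close> gives
  \<open>z = (1 + \<i> t) / (1 - \<i> t)\<close>, and absorbing the denominator into
  \<open>\<alpha>\<close> makes the parametrization polynomial. The flag \<open>s\<close> covers
  \<open>z = -1\<close> and the degenerate cases \<open>q = 0\<close> and
  \<open>r = 0\<close>.\<close>

lemma cmod_eq_scaled_param:
  assumes "cmod p = r * cmod q" "r \<ge> 0"
  shows "\<exists>s \<alpha> t. if s then p = - (of_real r * \<alpha>) \<and> q = \<alpha>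
    else p = of_real r * \<alpha> * Complex 1 t \<and> q = \<alpha> * Complex 1 (- t)"
proof (cases "p = - (of_real r * q)")
  case True
  then show ?thesis by (intro exI[of _ True]) auto
next
  case False
  then have nz: "q \<noteq> 0" "r \<noteq> 0" using assms by auto
  define z where "z = p / (of_real r * q)"
  have p: "p = of_real r * q * z" using nz by (simp add: z_def)
  have "cmod z = 1" using assms nz by (simp add: z_def norm_mult norm_divide)
  then have z: "(Re z)\<^sup>2 + (Im z)\<^sup>2 = 1" by (simp add: cmod_power2[symmetric])
  have "z \<noteq> -1" using False p by auto
  have "1 + Re z \<noteq> 0"
  proof
    assume "1 + Re z = 0"
    then have "Re z = -1" by simp
    with z \<open>z \<noteq> -1\<close> show False by (auto simp: complex_eq_iff)
  qed
  define t where "t = Im z / (1 + Re z)"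
  have t: "Im z = t * (1 + Re z)" using \<open>1 + Re z \<noteq> 0\<close> by (simp add: t_def)
  have "(1 + Re z) * (Re z - 1 + t\<^sup>2 * (1 + Re z)) = (Re z)\<^sup>2 + (t * (1 + Re z))\<^sup>2 - 1"
    by (simp add: algebra_simps power2_eq_square)
  also have "\<dots> = 0" using z by (simp add: t[symmetric])
  finally have "Re z - 1 + t\<^sup>2 * (1 + Re z) = 0"
    using \<open>1 + Re z \<noteq> 0\<close> mult_eq_0_iff by blast
  then have "Re z + t * (t * (1 + Re z)) = 1"
    by (simp add: power2_eq_square)
  then have zt: "z * Complex 1 (- t) = Complex 1 t"
    using t by (auto simp: complex_eq_iff algebra_simps)
  let ?\<alpha> = "q / Complex 1 (- t)"
  have "Complex 1 (- t) \<noteq> 0" by (simp add: complex_eq_iff)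
  then have "q = ?\<alpha> * Complex 1 (- t)" by simp
  moreover have "p = of_real r * ?\<alpha> * Complex 1 t"
    unfolding zt[symmetric] p using \<open>Complex 1 (- t) \<noteq> 0\<close> by simp
  ultimately show ?thesis by (intro exI[of _ False] exI[of _ ?\<alpha>] exI[of _ t]) simp
qed

text \<open>
  Parametrizations of the zero set of the Hermitian form
  \<open>a * |\<psi>\<^sub>1|\<^sup>2 + c * |\<psi>\<^sub>2|\<^sup>2 + 2 * Re (b * \<psi>\<^sub>1 * cnj \<psi>\<^sub>2)\<close>. If \<open>a \<noteq> 0\<close>, the equation is
  \<open>|\<psi>\<^sub>1 + \<beta> * \<psi>\<^sub>2| = r * |\<psi>\<^sub>2|\<close> and \<open>\<kappa>\<close> is true; if \<open>a = c = 0\<close>, it says that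
  \<open>b * \<psi>\<^sub>1 * cnj \<psi>\<^sub>2\<close> is imaginary and \<open>\<kappa>\<close> is false. The flag \<open>s\<close> adds the points at
  infinity of the rational parametrization by \<open>t\<close>.
\<close>

definition form_zero :: "bool \<Rightarrow> bool \<Rightarrow> complex \<Rightarrow> real \<Rightarrow> complex \<Rightarrow> real \<Rightarrow> complex \<times> complex" where
  "form_zero \<kappa> s \<beta> r \<alpha> t =
    (if \<kappa> then
       if s then (- (of_real r * \<alpha>) - \<beta> * \<alpha>, \<alpha>)
       else (of_real r * \<alpha> * Complex 1 t - \<beta> * (\<alpha> * Complex 1 (- t)), \<alpha> * Complex 1 (- t))
     else if s then (\<alpha>, 0) else (Complex 0 t * \<alpha> * cnj \<beta>, \<alpha>))"

text \<open>Completing the square turns the equation into \<open>|\<psi>1 + \<beta> *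
  \<psi>2|\<^sup>2 = \<rho> * |\<psi>2|\<^sup>2\<close>, with \<open>\<beta>\<close> and
  \<open>\<rho>\<close> depending on the form alone.\<close>

lemma form_zero_exists:
  fixes a c :: real and b \<psi>1 \<psi>2 :: complex
  assumes "a \<noteq> 0"
    and "a * (cmod \<psi>1)\<^sup>2 + c * (cmod \<psi>2)\<^sup>2 + 2 * Re (b * \<psi>1 * cnj \<psi>2) = 0"
  shows "\<exists>s \<alpha> t. (\<psi>1, \<psi>2) =
    form_zero True s (cnj b / of_real a) (sqrt (max 0 ((cmod b)\<^sup>2 / a\<^sup>2 - c / a))) \<alpha> t"
proof -
  define \<beta> where "\<beta> = cnj b / of_real a"
  define \<rho> where "\<rho> = (cmod b)\<^sup>2 / a\<^sup>2 - c / a"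
  define p where "p = \<psi>1 + \<beta> * \<psi>2"
  have "a\<^sup>2 * (cmod p)\<^sup>2 = (cmod (of_real a * \<psi>1 + cnj b * \<psi>2))\<^sup>2"
  proof -
    have "of_real a * \<psi>1 + cnj b * \<psi>2 = of_real a * p"
      using assms(1) by (simp add: p_def \<beta>_def field_simps)
    then show ?thesis by (simp add: norm_mult power_mult_distrib)
  qed
  also have "\<dots> = a * (a * (cmod \<psi>1)\<^sup>2 + c * (cmod \<psi>2)\<^sup>2 + 2 * Re (b * \<psi>1 * cnj \<psi>2))
      + ((cmod b)\<^sup>2 - a * c) * (cmod \<psi>2)\<^sup>2"
    by (simp add: cmod_power2) (simp add: algebra_simps power2_eq_square)
  also have "\<dots> = a\<^sup>2 * (\<rho> * (cmod \<psi>2)\<^sup>2)"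
    using assms by (simp add: \<rho>_def field_simps power2_eq_square)
  finally have p: "(cmod p)\<^sup>2 = \<rho> * (cmod \<psi>2)\<^sup>2" using assms(1) by simp
  have "cmod p = sqrt (max 0 \<rho>) * cmod \<psi>2"
  proof (cases "\<rho> \<ge> 0")
    case True
    then have "(cmod p)\<^sup>2 = (sqrt (max 0 \<rho>) * cmod \<psi>2)\<^sup>2" using p by (simp add: power_mult_distrib)
    then show ?thesis by (rule power2_eq_imp_eq) (use True in auto)
  next
    \<comment> \<open>For negative \<open>\<rho>\<close> the form is definite: its only zero has
      \<open>p = \<psi>2 = 0\<close>, which radius \<open>0\<close> also describes.\<close>
    case False
    then have "\<rho> * (cmod \<psi>2)\<^sup>2 \<le> 0" by (simp add: mult_le_0_iff)
    with p have "(cmod p)\<^sup>2 \<le> 0" by simp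
    then have "p = 0" by simp
    with False p show ?thesis by auto
  qed
  from cmod_eq_scaled_param[OF this] obtain s \<alpha> t where
    "if s then p = - (of_real (sqrt (max 0 \<rho>)) * \<alpha>) \<and> \<psi>2 = \<alpha>
     else p = of_real (sqrt (max 0 \<rho>)) * \<alpha> * Complex 1 t \<and> \<psi>2 = \<alpha> * Complex 1 (- t)"
    by auto
  moreover have "\<psi>1 = p - \<beta> * \<psi>2" by (simp add: p_def)
  ultimately have "(\<psi>1, \<psi>2) = form_zero True s \<beta> (sqrt (max 0 \<rho>)) \<alpha> t"
    by (cases s) (simp_all add: form_zero_def)
  then show ?thesis unfolding \<beta>_def \<rho>_def by blast
qed

text \<open>Multiplying the imaginary number \<open>b * \<psi>1 * cnj \<psi>2\<close> by
  \<open>\<psi>2 * cnj b\<close> gives a positive multiple of \<open>\<psi>1\<close> when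
  \<open>\<psi>2\<close> is non-zero.\<close>

lemma form_zero_exists_off_diagonal:
  assumes "b \<noteq> 0" "Re (b * \<psi>1 * cnj \<psi>2) = 0"
  shows "\<exists>s \<alpha> t. (\<psi>1, \<psi>2) = form_zero False s b r \<alpha> t"
proof (cases "\<psi>2 = 0")
  case True
  then show ?thesis by (intro exI[of _ True]) (simp add: form_zero_def)
next
  case False
  define w where "w = b * \<psi>1 * cnj \<psi>2"
  have w: "w = Complex 0 (Im w)" using assms(2) by (simp add: w_def complex_eq_iff)
  let ?n = "(cmod b)\<^sup>2 * (cmod \<psi>2)\<^sup>2"
  have "of_real ?n * \<psi>1 = w * \<psi>2 * cnj b"
    by (simp add: w_def complex_norm_square mult_ac flip: of_real_power)
  moreover have "?n \<noteq> 0" using False assms(1) by simp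
  ultimately have "\<psi>1 = (w / of_real ?n) * \<psi>2 * cnj b"
    by (metis (no_types, lifting) nonzero_mult_div_cancel_left of_real_eq_0_iff times_divide_eq_left)
  also have "w / of_real ?n = Complex 0 (Im w / ?n)"
    by (subst w) (simp add: complex_eq_iff)
  finally show ?thesis
    by (intro exI[of _ False] exI[of _ \<psi>2] exI[of _ "Im w / ?n"]) (simp add: form_zero_def)
qed

text \<open>The order of quantifiers matters for the parameter count: \<open>\<kappa>\<close>,
  \<open>\<beta>\<close>, \<open>r\<close> and the order of the coordinates depend on the form only,
  so all columns of a frame share them. The second disjunct exchanges the coordinates when only the
  second diagonal coefficient is known to be non-zero.\<close>

lemma equal_intensity_pair_param:
  fixes x1 x2 y1 y2 :: complex
  assumes "\<nexists>\<theta>::real. y1 = exp (\<i> * of_real \<theta>) * x1 \<and> y2 = exp (\<i> * of_real \<theta>) * x2"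
  shows "\<exists>\<kappa> \<beta> r.
    (\<forall>\<psi>1 \<psi>2. cmod (x1 * \<psi>1 + x2 * \<psi>2) = cmod (y1 * \<psi>1 + y2 * \<psi>2) \<longrightarrow>
       (\<exists>s \<alpha> t. (\<psi>1, \<psi>2) = form_zero \<kappa> s \<beta> r \<alpha> t)) \<or>
    (\<forall>\<psi>1 \<psi>2. cmod (x1 * \<psi>1 + x2 * \<psi>2) = cmod (y1 * \<psi>1 + y2 * \<psi>2) \<longrightarrow>
       (\<exists>s \<alpha> t. (\<psi>2, \<psi>1) = form_zero \<kappa> s \<beta> r \<alpha> t))"
proof -
  define a where "a = (cmod x1)\<^sup>2 - (cmod y1)\<^sup>2"
  define c where "c = (cmod x2)\<^sup>2 - (cmod y2)\<^sup>2"
  define b where "b = x1 * cnj x2 - y1 * cnj y2"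
  have form: "a * (cmod \<psi>1)\<^sup>2 + c * (cmod \<psi>2)\<^sup>2 + 2 * Re (b * \<psi>1 * cnj \<psi>2) = 0"
    if "cmod (x1 * \<psi>1 + x2 * \<psi>2) = cmod (y1 * \<psi>1 + y2 * \<psi>2)" for \<psi>1 \<psi>2
  proof -
    have "(cmod (x1 * \<psi>1 + x2 * \<psi>2))\<^sup>2 = (cmod (y1 * \<psi>1 + y2 * \<psi>2))\<^sup>2" using that by simp
    then show ?thesis
      unfolding a_def b_def c_def
      by (simp add: cmod_power2) (simp add: algebra_simps power2_eq_square)
  qed
  consider "a \<noteq> 0" | "c \<noteq> 0" | "a = 0" "c = 0" "b \<noteq> 0"
    using phase_equiv_pair[of x1 y1 x2 y2] assms by (auto simp: a_def b_def c_def)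
  then show ?thesis
  proof cases
    case 1
    from form_zero_exists[OF 1 form] show ?thesis
      by blast
  next
    case 2
    have "c * (cmod \<psi>2)\<^sup>2 + a * (cmod \<psi>1)\<^sup>2 + 2 * Re (cnj b * \<psi>2 * cnj \<psi>1) = 0"
      if "cmod (x1 * \<psi>1 + x2 * \<psi>2) = cmod (y1 * \<psi>1 + y2 * \<psi>2)" for \<psi>1 \<psi>2
      using form[OF that] by (simp add: algebra_simps)
    from form_zero_exists[OF 2 this] show ?thesis
      by blast
  next
    case 3
    have "Re (b * \<psi>1 * cnj \<psi>2) = 0"
      if "cmod (x1 * \<psi>1 + x2 * \<psi>2) = cmod (y1 * \<psi>1 + y2 * \<psi>2)" for \<psi>1 \<psi>2
      using form[OF that] 3 by simp
    from form_zero_exists_off_diagonal[OF 3(3) this] show ?thesis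
      by blast
  qed
qed

text \<open>\<open>v\<close> and \<open>w\<close> form a reduced echelon basis, with pivots
  \<open>i\<close> and \<open>j\<close>, of a plane containing \<open>x\<close> and
  \<open>y\<close>. The normalization leaves only the other \<open>M - 2\<close> coordinates of each
  of them free.\<close>

lemma two_pivots:
  fixes x y :: "complex ^ 'm"
  assumes "CARD('m) \<ge> 2"
  obtains i j v w where "i \<noteq> j" "v $ i = 1" "v $ j = 0" "w $ i = 0" "w $ j = 1"
    "\<And>k. x $ k = x $ i * v $ k + x $ j * w $ k" "\<And>k. y $ k = y $ i * v $ k + y $ j * w $ k"
proof (cases "\<exists>i j. x $ i * y $ j - x $ j * y $ i \<noteq> 0")
  case True
  then obtain i j where d: "x $ i * y $ j - x $ j * y $ i \<noteq> 0" (is "?d \<noteq> 0") by blast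
  \<comment> \<open>Cramer's rule for a non-vanishing minor of \<open>x\<close> and
    \<open>y\<close>.\<close>
  let ?v = "\<chi> k. (y $ j * x $ k - x $ j * y $ k) / ?d"
  let ?w = "\<chi> k. (x $ i * y $ k - y $ i * x $ k) / ?d"
  show ?thesis
  proof (rule that[of i j ?v ?w])
    show "i \<noteq> j" using d by auto
  qed (use d in \<open>simp_all add: divide_simps, simp_all add: algebra_simps\<close>)
next
  case False
  then have minor: "x $ i * y $ j = x $ j * y $ i" for i j by auto
  obtain z i where zi: "z $ i = 1" and x: "\<And>k. x $ k = x $ i * z $ k"
    and y: "\<And>k. y $ k = y $ i * z $ k"
  proof -
    consider i where "x $ i \<noteq> 0" | i where "y $ i \<noteq> 0" | "x = 0" "y = 0"
      by (auto simp: vec_eq_iff)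
    then show ?thesis
    proof cases
      case (1 i)
      have *: "y $ k = y $ i * (x $ k / x $ i)" for k
        using minor[of i k] 1 by (metis mult.commute nonzero_mult_div_cancel_left times_divide_eq_right)
      show ?thesis
      proof (rule that[of "\<chi> k. x $ k / x $ i" i])
        show "y $ k = y $ i * (\<chi> k. x $ k / x $ i) $ k" for k
          unfolding vec_lambda_beta by (rule *)
      qed (use 1 in simp_all)
    next
      case (2 i)
      have *: "x $ k = x $ i * (y $ k / y $ i)" for k
        using minor[of k i] 2 by (metis mult.commute nonzero_mult_div_cancel_left times_divide_eq_right)
      show ?thesis
      proof (rule that[of "\<chi> k. y $ k / y $ i" i])
        show "x $ k = x $ i * (\<chi> k. y $ k / y $ i) $ k" for k
          unfolding vec_lambda_beta by (rule *)
      qed (use 2 in simp_all)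
    next
      case 3
      then show ?thesis using that[of 1 undefined] by simp
    qed
  qed
  obtain j where j: "i \<noteq> j"
  proof -
    have "UNIV \<noteq> {i}"
    proof
      assume "UNIV = {i}"
      then have "CARD('m) = card {i}" by (rule arg_cong)
      with assms show False by simp
    qed
    then obtain j where "j \<noteq> i" by auto
    then show ?thesis using that[of j] by simp
  qed
  show ?thesis
  \<comment> \<open>Here \<open>x\<close> and \<open>y\<close> lie on the line of \<open>z\<close>;
    a unit vector completes it to a plane, and \<open>z\<close> is cleared at the second
    pivot.\<close>
  proof (rule that[of i j "z - (z $ j) *s axis j 1" "axis j 1"])
    show "x $ k = x $ i * (z - z $ j *s axis j 1) $ k + x $ j * axis j 1 $ k" for k
      using x[of k] x[of j] by (cases "k = j") (simp_all add: axis_def)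
    show "y $ k = y $ i * (z - z $ j *s axis j 1) $ k + y $ j * axis j 1 $ k" for k
      using y[of k] y[of j] by (cases "k = j") (simp_all add: axis_def)
  qed (use j zi in \<open>auto simp: axis_def\<close>)
qed

section \<open>The parameters of a non-injective frame\<close>

text \<open>\<open>Pivot_1\<close> and \<open>Pivot_2\<close> hold the free coordinates of
  \<open>v\<close> and \<open>w\<close>, \<open>Form_coeff\<close> holds \<open>\<beta>\<close>,
  \<open>Scale n\<close> holds \<open>\<alpha>\<close> for column \<open>n\<close>, and
  \<open>Entry\<close> holds the matrix entries outside the pivot rows. The real parameters
  \<open>Radius\<close> and \<open>Slope n\<close> below hold \<open>r\<close> and
  \<open>t\<close>.\<close>

datatype ('m, 'n) complex_param =
  Pivot_1 'm | Pivot_2 'm | Form_coeff | Scale 'n | Entry 'm 'n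

datatype ('m, 'n) param =
  Re_of "('m, 'n) complex_param" | Im_of "('m, 'n) complex_param" | Radius | Slope 'n

definition complex_params :: "'m \<Rightarrow> 'm \<Rightarrow> ('m::finite, 'n::finite) complex_param set" where
  "complex_params i j = Pivot_1 ` (- {i, j}) \<union> (Pivot_2 ` (- {i, j}) \<union>
     ({Form_coeff} \<union> (range Scale \<union> case_prod Entry ` ((- {i, j}) \<times> UNIV))))"

definition params :: "'m \<Rightarrow> 'm \<Rightarrow> ('m::finite, 'n::finite) param set" where
  "params i j = Re_of ` complex_params i j \<union> (Im_of ` complex_params i j \<union> ({Radius} \<union> range Slope))"

lemma finite_complex_params: "finite (complex_params i j)"
  unfolding complex_params_def by simp

lemma finite_params [simp]: "finite (params i j)"
  unfolding params_def by (simp add: finite_complex_params)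

text \<open>The count is \<open>4M - 5 + N (2M - 1)\<close>, stated additively to avoid truncated
  subtraction.\<close>

lemma card_params:
  assumes "i \<noteq> j"
  shows "card (params i j :: ('m::finite, 'n::finite) param set) + CARD('n) + 5 =
    4 * CARD('m) + 2 * CARD('m) * CARD('n)"
proof -
  let ?R = "- {i, j}"
  have R: "card ?R + 2 = CARD('m)"
    using card_Un_disjoint[of ?R "{i, j}", unfolded Compl_partition2] assms by simp
  have Entry: "card (case_prod Entry ` (?R \<times> (UNIV :: 'n set))) = card ?R * CARD('n)"
    by (subst card_image) (auto simp: inj_on_def)
  have "card (complex_params i j :: ('m, 'n) complex_param set) =
      2 * card ?R + 1 + CARD('n) + card ?R * CARD('n)"
    unfolding complex_params_def
    by (subst card_Un_disjoint, (auto simp: finite_complex_params)[3])+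
       (simp add: card_image inj_on_def Entry)
  moreover have "card (params i j :: ('m, 'n) param set) =
      2 * card (complex_params i j :: ('m, 'n) complex_param set) + 1 + CARD('n)"
    unfolding params_def
    by (subst card_Un_disjoint, (auto simp: finite_complex_params)[3])+
       (simp add: card_image inj_on_def)
  ultimately show ?thesis
    unfolding R[symmetric] by (simp add: algebra_simps)
qed

definition complex_value :: "(('m, 'n) param \<Rightarrow> real) \<Rightarrow> ('m, 'n) complex_param \<Rightarrow> complex" where
  "complex_value x c = Complex (x (Re_of c)) (x (Im_of c))"

text \<open>
  The rows \<open>i\<close> and \<open>j\<close> of the matrix are solved from the prescribed values \<open>(\<psi>\<^sub>1, \<psi>\<^sub>2)\<close> of
  \<open>cinner v\<close> and \<open>cinner w\<close> on the columns, where \<open>v\<close> and \<open>w\<close> restrict to \<open>(1, 0)\<close> and \<open>(0, 1)\<close> on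
  these rows.
\<close>

definition chart_form ::
  "bool \<Rightarrow> ('n \<Rightarrow> bool) \<Rightarrow> (('m, 'n) param \<Rightarrow> real) \<Rightarrow> 'n \<Rightarrow> complex \<times> complex" where
  "chart_form \<kappa> s x n = form_zero \<kappa> (s n) (complex_value x Form_coeff) (x Radius)
     (complex_value x (Scale n)) (x (Slope n))"

definition chart_entry ::
  "'m \<Rightarrow> 'm \<Rightarrow> bool \<Rightarrow> ('n \<Rightarrow> bool) \<Rightarrow> (('m::finite, 'n::finite) param \<Rightarrow> real) \<Rightarrow> 'm \<Rightarrow> 'n \<Rightarrow> complex"
where
  "chart_entry i j \<kappa> s x k n =
    (if k = i then cnj (fst (chart_form \<kappa> s x n) -
       (\<Sum>l\<in>- {i, j}. complex_value x (Pivot_1 l) * cnj (complex_value x (Entry l n))))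
     else if k = j then cnj (snd (chart_form \<kappa> s x n) -
       (\<Sum>l\<in>- {i, j}. complex_value x (Pivot_2 l) * cnj (complex_value x (Entry l n))))
     else complex_value x (Entry k n))"

definition chart ::
  "'m \<Rightarrow> 'm \<Rightarrow> bool \<Rightarrow> ('n \<Rightarrow> bool) \<Rightarrow> (('m::finite, 'n::finite) param \<Rightarrow> real) \<Rightarrow>
    (real ^ 'n ^ 'm) \<times> (real ^ 'n ^ 'm)"
where
  "chart i j \<kappa> s x =
    (\<chi> k n. Re (chart_entry i j \<kappa> s x k n), \<chi> k n. Im (chart_entry i j \<kappa> s x k n))"

section \<open>Polynomiality and covering property of the charts\<close>

definition complex_poly_on :: "'i set \<Rightarrow> (('i \<Rightarrow> real) \<Rightarrow> complex) \<Rightarrow> bool" where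
  "complex_poly_on I f \<longleftrightarrow> poly_on I (\<lambda>x. Re (f x)) \<and> poly_on I (\<lambda>x. Im (f x))"

lemma complex_poly_on_intros:
  assumes "finite I"
  shows "complex_poly_on I (\<lambda>_. z)"
    and "poly_on I f \<Longrightarrow> poly_on I g \<Longrightarrow> complex_poly_on I (\<lambda>x. Complex (f x) (g x))"
    and "poly_on I f \<Longrightarrow> complex_poly_on I (\<lambda>x. of_real (f x))"
    and "complex_poly_on I F \<Longrightarrow> complex_poly_on I (\<lambda>x. cnj (F x))"
    and "complex_poly_on I F \<Longrightarrow> complex_poly_on I (\<lambda>x. - F x)"
    and "complex_poly_on I F \<Longrightarrow> complex_poly_on I G \<Longrightarrow> complex_poly_on I (\<lambda>x. F x - G x)"
    and "complex_poly_on I F \<Longrightarrow> complex_poly_on I G \<Longrightarrow> complex_poly_on I (\<lambda>x. F x * G x)"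
  using assms unfolding complex_poly_on_def
  by (auto intro: poly_on_const poly_on_uminus poly_on_add poly_on_diff poly_on_mult)

lemma complex_poly_on_sum:
  assumes "finite I" "\<And>j. j \<in> J \<Longrightarrow> complex_poly_on I (\<lambda>x. F x j)"
  shows "complex_poly_on I (\<lambda>x. \<Sum>j\<in>J. F x j)"
  using assms unfolding complex_poly_on_def by (auto intro: poly_on_sum)

lemma complex_poly_on_form_zero:
  assumes "finite I" "complex_poly_on I \<beta>" "poly_on I r" "complex_poly_on I \<alpha>" "poly_on I t"
  shows "complex_poly_on I (\<lambda>x. fst (form_zero \<kappa> s (\<beta> x) (r x) (\<alpha> x) (t x)))"
    and "complex_poly_on I (\<lambda>x. snd (form_zero \<kappa> s (\<beta> x) (r x) (\<alpha> x) (t x)))"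
  using assms unfolding form_zero_def
  by (cases \<kappa>; cases s; simp add: complex_poly_on_intros poly_on_const poly_on_uminus)+

lemma complex_poly_on_chart_entry:
  "complex_poly_on (params i j) (\<lambda>x. chart_entry i j \<kappa> s x k n)"
proof -
  let ?I = "params i j :: ('a, 'b) param set"
  have val: "complex_poly_on ?I (\<lambda>x. complex_value x c)" if "c \<in> complex_params i j" for c
    unfolding complex_value_def using that
    by (intro complex_poly_on_intros(2) poly_on_var finite_params) (auto simp: params_def)
  have form: "complex_poly_on ?I (\<lambda>x. fst (chart_form \<kappa> s x n))"
    "complex_poly_on ?I (\<lambda>x. snd (chart_form \<kappa> s x n))"
    unfolding chart_form_def
    by (intro complex_poly_on_form_zero val poly_on_var finite_params;
        auto simp: params_def complex_params_def)+
  show ?thesis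
  proof (cases "k = i \<or> k = j")
    case True
    then show ?thesis
      unfolding chart_entry_def
      by (cases "k = i"; simp; intro complex_poly_on_intros complex_poly_on_sum form val finite_params;
          auto simp: complex_params_def)
  next
    case False
    then show ?thesis
      unfolding chart_entry_def using val[of "Entry k n"] by (auto simp: complex_params_def)
  qed
qed

lemma poly_on_chart: "poly_on (params i j) (\<lambda>x. chart i j \<kappa> s x \<bullet> b)"
  unfolding chart_def inner_prod_def inner_vec_def
  using complex_poly_on_chart_entry[of i j \<kappa> s, unfolded complex_poly_on_def]
  by (auto intro!: poly_on_add poly_on_sum poly_on_mult poly_on_const)

text \<open>As \<open>v\<close> is \<open>1\<close> at \<open>i\<close> and \<open>0\<close> at
  \<open>j\<close>, the value of \<open>cinner v\<close> on a column together with the entries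
  outside the pivot rows determines the entry in row \<open>i\<close>; \<open>w\<close> does the
  same for row \<open>j\<close>. So the chart, evaluated at the parameters read off from
  \<open>P\<close>, returns \<open>P\<close>.\<close>

lemma chart_covers:
  assumes "i \<noteq> j" "v $ i = 1" "v $ j = 0" "w $ i = 0" "w $ j = 1"
    and "\<And>n. \<exists>s \<alpha> t. (cinner v (column n (complex_matrix P)), cinner w (column n (complex_matrix P))) =
      form_zero \<kappa> s \<beta> r \<alpha> t"
  shows "\<exists>s. P \<in> range (chart i j \<kappa> s)"
proof -
  let ?\<Phi> = "complex_matrix P"
  obtain s \<alpha> t where form: "\<And>n. (cinner v (column n ?\<Phi>), cinner w (column n ?\<Phi>)) =
      form_zero \<kappa> (s n) \<beta> r (\<alpha> n) (t n)"
    using assms(6) by metis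
  define g where "g = (\<lambda>c. case c of Pivot_1 k \<Rightarrow> v $ k | Pivot_2 k \<Rightarrow> w $ k | Form_coeff \<Rightarrow> \<beta>
    | Scale n \<Rightarrow> \<alpha> n | Entry k n \<Rightarrow> ?\<Phi> $ k $ n)"
  define x where "x = (\<lambda>p. case p of Re_of c \<Rightarrow> Re (g c) | Im_of c \<Rightarrow> Im (g c)
    | Radius \<Rightarrow> r | Slope n \<Rightarrow> t n)"
  have val: "complex_value x c = g c" for c
    by (simp add: complex_value_def x_def)
  have form': "chart_form \<kappa> s x n = (cinner v (column n ?\<Phi>), cinner w (column n ?\<Phi>))" for n
    unfolding form chart_form_def val by (simp add: g_def x_def)
  have split: "(\<Sum>k\<in>UNIV. f k) = f i + f j + (\<Sum>k\<in>- {i, j}. f k)" for f :: "_ \<Rightarrow> complex"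
    using assms(1) sum.subset_diff[of "{i, j}" UNIV f] by (simp add: Compl_eq_Diff_UNIV add.commute)
  have entry: "chart_entry i j \<kappa> s x k n = ?\<Phi> $ k $ n" for k n
    using assms(1-5) unfolding chart_entry_def form' val
    by (auto simp: g_def cinner_def split column_def)
  have "chart i j \<kappa> s x = P"
    unfolding chart_def entry by (simp add: complex_matrix_def prod_eq_iff vec_eq_iff)
  then show ?thesis by blast
qed

section \<open>Injectivity of the intensity map\<close>

lemma inj_intensity_map_iff:
  "inj (intensity_map \<Phi>) \<longleftrightarrow>
    (\<forall>x y. (\<forall>n. cmod (cinner x (column n \<Phi>)) = cmod (cinner y (column n \<Phi>))) \<longrightarrow> phase_equiv x y)"
  unfolding inj_def by transfer (simp add: vec_eq_iff)

text \<open>A vector orthogonal to all columns has the same intensities as \<open>0\<close>, so it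
  is \<open>0\<close> up to a phase, hence zero.\<close>

lemma inj_intensity_map_imp_is_frame:
  assumes "inj (intensity_map \<Phi>)"
  shows "is_frame \<Phi>"
proof -
  have "x = 0" if x: "transpose \<Phi> *v x = 0" for x
  proof -
    \<comment> \<open>The matrix product is bilinear whereas \<open>cinner\<close> conjugates the
      column, so the kernel vector has to be conjugated.\<close>
    let ?y = "\<chi> k. cnj (x $ k)"
    have "cnj (cinner ?y (column n \<Phi>)) = (transpose \<Phi> *v x) $ n" for n
      by (simp add: cinner_def column_def matrix_vector_mult_def transpose_def mult.commute)
    then have "cinner ?y (column n \<Phi>) = 0" for n
      using x by (metis complex_cnj_zero_iff zero_index)
    moreover have "cinner 0 (column n \<Phi>) = 0" for n
      by (simp add: cinner_def)
    ultimately have "phase_equiv 0 ?y"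
      using assms unfolding inj_intensity_map_iff by simp
    then show ?thesis
      by (auto simp: phase_equiv_def vec_eq_iff)
  qed
  then have "\<exists>B. B ** transpose \<Phi> = mat 1"
    by (simp add: matrix_left_invertible_ker)
  then show ?thesis
    unfolding is_frame_def left_invertible_transpose
    by (simp add: matrix_right_invertible_span_columns)
qed

text \<open>In the basis \<open>v\<close>, \<open>w\<close> the problem becomes two-dimensional:
  \<open>x\<close> and \<open>y\<close> reduce to their pivot coordinates, and each column to its
  pair of values under \<open>cinner v\<close> and \<open>cinner w\<close>.\<close>

lemma not_inj_in_chart:
  fixes P :: "(real ^ 'n ^ 'm) \<times> (real ^ 'n ^ 'm)"
  assumes "CARD('m) \<ge> 2" "\<not> inj (intensity_map (complex_matrix P))"
  shows "\<exists>i j \<kappa> s. i \<noteq> j \<and> P \<in> range (chart i j \<kappa> s)"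
proof -
  let ?\<phi> = "\<lambda>n. column n (complex_matrix P)"
  obtain x y where xy: "\<And>n. cmod (cinner x (?\<phi> n)) = cmod (cinner y (?\<phi> n))" "\<not> phase_equiv x y"
    using assms(2) unfolding inj_intensity_map_iff by blast
  obtain i j v w where ij: "i \<noteq> j" and v: "v $ i = 1" "v $ j = 0" and w: "w $ i = 0" "w $ j = 1"
    and x: "\<And>k. x $ k = x $ i * v $ k + x $ j * w $ k"
    and y: "\<And>k. y $ k = y $ i * v $ k + y $ j * w $ k"
    using two_pivots[OF assms(1), of x y] by metis
  have expand: "cinner z p = z $ i * cinner v p + z $ j * cinner w p"
    if "\<And>k. z $ k = z $ i * v $ k + z $ j * w $ k" for z p
  proof -
    have "cinner z p = (\<Sum>k\<in>UNIV. (z $ i * v $ k + z $ j * w $ k) * cnj (p $ k))"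
      unfolding cinner_def by (rule sum.cong[OF refl]) (subst that, rule refl)
    then show ?thesis
      by (simp add: cinner_def distrib_right sum.distrib sum_distrib_left mult.assoc)
  qed
  have "\<nexists>\<theta>::real. y $ i = exp (\<i> * of_real \<theta>) * x $ i \<and> y $ j = exp (\<i> * of_real \<theta>) * x $ j"
  proof
    assume "\<exists>\<theta>::real. y $ i = exp (\<i> * of_real \<theta>) * x $ i \<and> y $ j = exp (\<i> * of_real \<theta>) * x $ j"
    then obtain \<theta> :: real where \<theta>: "y $ i = exp (\<i> * of_real \<theta>) * x $ i"
      "y $ j = exp (\<i> * of_real \<theta>) * x $ j" by blast
    have "y $ k = exp (\<i> * of_real \<theta>) * x $ k" for k
      by (subst y, subst x[of k]) (simp add: \<theta> distrib_left mult.assoc)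
    then have "phase_equiv x y"
      unfolding phase_equiv_def by (intro exI[of _ \<theta>]) (simp add: vec_eq_iff)
    with xy(2) show False ..
  qed
  from equal_intensity_pair_param[OF this] obtain \<kappa> \<beta> r where
    "(\<forall>\<psi>1 \<psi>2. cmod (x $ i * \<psi>1 + x $ j * \<psi>2) = cmod (y $ i * \<psi>1 + y $ j * \<psi>2) \<longrightarrow>
       (\<exists>s \<alpha> t. (\<psi>1, \<psi>2) = form_zero \<kappa> s \<beta> r \<alpha> t)) \<or>
     (\<forall>\<psi>1 \<psi>2. cmod (x $ i * \<psi>1 + x $ j * \<psi>2) = cmod (y $ i * \<psi>1 + y $ j * \<psi>2) \<longrightarrow>
       (\<exists>s \<alpha> t. (\<psi>2, \<psi>1) = form_zero \<kappa> s \<beta> r \<alpha> t))"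
    by blast
  moreover have "cmod (x $ i * cinner v (?\<phi> n) + x $ j * cinner w (?\<phi> n)) =
      cmod (y $ i * cinner v (?\<phi> n) + y $ j * cinner w (?\<phi> n))" for n
    using xy(1)[of n] by (simp add: expand[OF x] expand[OF y])
  ultimately have "(\<forall>n. \<exists>s \<alpha> t. (cinner v (?\<phi> n), cinner w (?\<phi> n)) = form_zero \<kappa> s \<beta> r \<alpha> t) \<or>
      (\<forall>n. \<exists>s \<alpha> t. (cinner w (?\<phi> n), cinner v (?\<phi> n)) = form_zero \<kappa> s \<beta> r \<alpha> t)"
    by blast
  then show ?thesis
  proof
    assume *: "\<forall>n. \<exists>s \<alpha> t. (cinner v (?\<phi> n), cinner w (?\<phi> n)) = form_zero \<kappa> s \<beta> r \<alpha> t"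
    show ?thesis
      using chart_covers[OF ij v w *[rule_format]] ij by metis
  next
    \<comment> \<open>Exchanging the two values amounts to exchanging \<open>v\<close> with
      \<open>w\<close> and the pivot \<open>i\<close> with \<open>j\<close>.\<close>
    assume *: "\<forall>n. \<exists>s \<alpha> t. (cinner w (?\<phi> n), cinner v (?\<phi> n)) = form_zero \<kappa> s \<beta> r \<alpha> t"
    show ?thesis
      using chart_covers[OF ij[symmetric] w(2,1) v(2,1) *[rule_format]] ij by metis
  qed
qed

lemma inj_intensity_map_dim_1:
  fixes P :: "(real ^ 'n ^ 'm) \<times> (real ^ 'n ^ 'm)"
  assumes "CARD('m) = 1" "P \<noteq> 0"
  shows "inj (intensity_map (complex_matrix P))"
proof -
  obtain i :: 'm where i: "UNIV = {i}" using assms(1) by (metis card_1_singletonE)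
  then have all: "k = i" for k by blast
  obtain n where n: "complex_matrix P $ i $ n \<noteq> 0"
  proof -
    have "\<exists>k n. fst P $ k $ n \<noteq> 0 \<or> snd P $ k $ n \<noteq> 0"
      using assms(2) by (auto simp: prod_eq_iff vec_eq_iff)
    then obtain n where "fst P $ i $ n \<noteq> 0 \<or> snd P $ i $ n \<noteq> 0"
      using all by metis
    then show ?thesis
      by (intro that[of n]) (simp add: complex_matrix_def complex_eq_iff)
  qed
  show ?thesis
    unfolding inj_intensity_map_iff
  proof (intro allI impI)
    fix x y assume "\<forall>n. cmod (cinner x (column n (complex_matrix P))) =
        cmod (cinner y (column n (complex_matrix P)))"
    then have "cmod (cinner x (column n (complex_matrix P))) =
        cmod (cinner y (column n (complex_matrix P)))" ..
    then have "cmod (x $ i) = cmod (y $ i)"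
      using n by (simp add: cinner_def i column_def norm_mult)
    then obtain \<theta> :: real where "y $ i = exp (\<i> * of_real \<theta>) * x $ i"
      using phase_equiv_pair[of "x $ i" "y $ i" 0 0] by auto
    then show "phase_equiv x y"
      unfolding phase_equiv_def vec_eq_iff by (metis all vector_smult_component)
  qed
qed

theorem theorem1p1:
  assumes "CARD('n::finite) \<ge> 4 * CARD('m::finite) - 4"
  shows "\<exists>\<U> :: ((real ^ 'n ^ 'm) \<times> (real ^ 'n ^ 'm)) set.
           zariski_open \<U> \<and> \<U> \<noteq> {} \<and>
           (\<forall>P\<in>\<U>. is_frame (complex_matrix P) \<and> inj (intensity_map (complex_matrix P)))"
proof -
  have "\<exists>\<U> :: ((real ^ 'n ^ 'm) \<times> (real ^ 'n ^ 'm)) set. zariski_open \<U> \<and> \<U> \<noteq> {} \<and>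
      (\<forall>P\<in>\<U>. inj (intensity_map (complex_matrix P)))"
  proof (cases "CARD('m) \<ge> 2")
    case True
    \<comment> \<open>There is one chart for each choice of pivots, form type and flag per column:
      finitely many in all.\<close>
    let ?K = "{(i, j, \<kappa>, s) | (i :: 'm) (j :: 'm) (\<kappa> :: bool) (s :: 'n \<Rightarrow> bool). i \<noteq> j}"
    let ?I = "\<lambda>(i, j, \<kappa>, s). params i j :: ('m, 'n) param set"
    let ?F = "\<lambda>(i, j, \<kappa>, s). chart i j \<kappa> s :: _ \<Rightarrow> (real ^ 'n ^ 'm) \<times> (real ^ 'n ^ 'm)"
    \<comment> \<open>This is where \<open>N \<ge> 4M - 4\<close> enters; in the case of equality
      there is exactly one parameter fewer than \<open>2MN\<close>.\<close>
    have "card (params i j :: ('m, 'n) param set) < DIM((real ^ 'n ^ 'm) \<times> (real ^ 'n ^ 'm))"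
      if "i \<noteq> j" for i j :: 'm
      using card_params[OF that, where 'n = 'n] assms True by simp
    then have "\<exists>U. zariski_open U \<and> U \<noteq> {} \<and> (\<forall>y\<in>U. \<forall>\<kappa>\<in>?K. y \<notin> range (?F \<kappa>))"
      by (intro polynomial_images_avoid[where I = ?I]) (auto simp: poly_on_chart)
    then obtain U where U: "zariski_open U" "U \<noteq> {}" "\<forall>y\<in>U. \<forall>\<kappa>\<in>?K. y \<notin> range (?F \<kappa>)"
      by (elim exE conjE)
    have "inj (intensity_map (complex_matrix P))" if "P \<in> U" for P
      using not_inj_in_chart[OF True, of P] U(3) that by fastforce
    with U(1,2) show ?thesis by blast
  next
    case False
    moreover have "CARD('m) > 0" by simp
    ultimately have "CARD('m) = 1" by linarith
    \<comment> \<open>With \<open>M = 1\<close> there are no two pivots. Only the zero matrix has to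
      be avoided, and it is the image of a constant map in no variables.\<close>
    moreover have "\<exists>U :: ((real ^ 'n ^ 'm) \<times> (real ^ 'n ^ 'm)) set.
        zariski_open U \<and> U \<noteq> {} \<and> (\<forall>y\<in>U. \<forall>\<kappa>\<in>{()}. y \<notin> range (\<lambda>_ :: nat \<Rightarrow> real. 0))"
      by (intro polynomial_images_avoid[where I = "\<lambda>_. {}"]) (auto simp: poly_on_const)
    ultimately show ?thesis
      using inj_intensity_map_dim_1 by fastforce
  qed
  then show ?thesis
    using inj_intensity_map_imp_is_frame by blast
qed

end
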